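(* Let $a<b$ be real numbers. The linear operator $$C^1([a,b])\to L^2(\{a,b\}),\qquad u\mapsto u|_{\{a,b\}},$$ admits a unique extension to a bounded linear operator $$T_0:H^1(a,b)\to L^2(\{a,b\}).$$
   Context: For $m\in\mathbb{N}$ (here $m=1$), $C^m([a,b])$ is the set of all complex-valued $m$ times continuously differentiable functions on $[a,b]$. The space $H^m(a,b)$ is the completion of $C^m([a,b])$ with respect to the norm $$\|u\|_{H^m(a,b)}:=\Big(\sum_{j=0}^m\int_a^b|u^{(j)}(x)|^2\,dx\Big)^{1/2};$$ its elements are identified with the functions in $L^2(a,b)$ whose (weak) derivatives up to order $m$ also belong to $L^2(a,b)$. $L^2(\{a,b\})$ is the space of all functions $\varphi:\{a,b\}\to\mathbb{C}$, endowed with the norm $\|\varphi\|_{L^2(\{a,b\})}:=\big(|\varphi(a)|^2+|\varphi(b)|^2\big)^{1/2}$. *)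

theory Defs
  imports "HOL-Analysis.Analysis"
begin

section \<open>Complex normed spaces on explicit carriers\<close>

text \<open>
  The spaces below depend on the end points \<open>a\<close>, \<open>b\<close>, so they cannot be types; they are given as
  a carrier set together with the operations on it.
\<close>

record 'v cspace =
  carr :: "'v set"
  add :: "'v \<Rightarrow> 'v \<Rightarrow> 'v"
  scl :: "complex \<Rightarrow> 'v \<Rightarrow> 'v"
  zer :: "'v"
  nrm :: "'v \<Rightarrow> real"

locale cnormed_space =
  fixes V :: "('v, 'm) cspace_scheme"
  assumes zer_closed: "zer V \<in> carr V"
    and add_closed: "\<lbrakk>x \<in> carr V; y \<in> carr V\<rbrakk> \<Longrightarrow> add V x y \<in> carr V"
    and scl_closed: "x \<in> carr V \<Longrightarrow> scl V c x \<in> carr V"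
    and add_assoc: "\<lbrakk>x \<in> carr V; y \<in> carr V; z \<in> carr V\<rbrakk> \<Longrightarrow>
      add V (add V x y) z = add V x (add V y z)"
    and add_comm: "\<lbrakk>x \<in> carr V; y \<in> carr V\<rbrakk> \<Longrightarrow> add V x y = add V y x"
    and add_zer: "x \<in> carr V \<Longrightarrow> add V x (zer V) = x"
    and add_neg: "x \<in> carr V \<Longrightarrow> add V x (scl V (- 1) x) = zer V"
    and scl_one: "x \<in> carr V \<Longrightarrow> scl V 1 x = x"
    and scl_scl: "x \<in> carr V \<Longrightarrow> scl V c (scl V d x) = scl V (c * d) x"
    and scl_add_left: "x \<in> carr V \<Longrightarrow> scl V (c + d) x = add V (scl V c x) (scl V d x)"
    and scl_add_right: "\<lbrakk>x \<in> carr V; y \<in> carr V\<rbrakk> \<Longrightarrow>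
      scl V c (add V x y) = add V (scl V c x) (scl V c y)"
    and nrm_eq_0: "\<lbrakk>x \<in> carr V; nrm V x = 0\<rbrakk> \<Longrightarrow> x = zer V"
    and nrm_scl: "x \<in> carr V \<Longrightarrow> nrm V (scl V c x) = cmod c * nrm V x"
    and nrm_triangle: "\<lbrakk>x \<in> carr V; y \<in> carr V\<rbrakk> \<Longrightarrow> nrm V (add V x y) \<le> nrm V x + nrm V y"

definition dst :: "('v, 'm) cspace_scheme \<Rightarrow> 'v \<Rightarrow> 'v \<Rightarrow> real" where
  "dst V x y = nrm V (add V x (scl V (- 1) y))"

definition linear_op :: "('v, 'm) cspace_scheme \<Rightarrow> ('w, 'n) cspace_scheme \<Rightarrow> ('v \<Rightarrow> 'w) \<Rightarrow> bool" where
  "linear_op V W T \<longleftrightarrow>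
     T \<in> carr V \<rightarrow> carr W \<and>
     (\<forall>x\<in>carr V. \<forall>y\<in>carr V. T (add V x y) = add W (T x) (T y)) \<and>
     (\<forall>c. \<forall>x\<in>carr V. T (scl V c x) = scl W c (T x))"

text \<open>
  Operators are extensional (\<open>undefined\<close> outside the carrier), so that two operators are equal as
  HOL functions iff they agree on the carrier.
\<close>

definition bounded_linear_op :: "('v, 'm) cspace_scheme \<Rightarrow> ('w, 'n) cspace_scheme \<Rightarrow> ('v \<Rightarrow> 'w) \<Rightarrow> bool" where
  "bounded_linear_op V W T \<longleftrightarrow>
     T \<in> extensional (carr V) \<and> linear_op V W T \<and>
     (\<exists>K. \<forall>x\<in>carr V. nrm W (T x) \<le> K * nrm V x)"


section \<open>Completion\<close>

definition cauchy_seqs :: "('v, 'm) cspace_scheme \<Rightarrow> (nat \<Rightarrow> 'v) set" where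
  "cauchy_seqs V = {s. (\<forall>n. s n \<in> carr V) \<and>
     (\<forall>e>0. \<exists>N. \<forall>m\<ge>N. \<forall>n\<ge>N. dst V (s m) (s n) < e)}"

definition null_rel :: "('v, 'm) cspace_scheme \<Rightarrow> ((nat \<Rightarrow> 'v) \<times> (nat \<Rightarrow> 'v)) set" where
  "null_rel V = {(s, t). s \<in> cauchy_seqs V \<and> t \<in> cauchy_seqs V \<and>
     (\<lambda>n. dst V (s n) (t n)) \<longlonglongrightarrow> 0}"

text \<open>
  Cauchy sequences modulo null sequences. The unions over representatives are unions of one and
  the same class, and the \<open>THE\<close> below exists uniquely.
\<close>

definition cauchy_completion :: "('v, 'm) cspace_scheme \<Rightarrow> (nat \<Rightarrow> 'v) set cspace" where
  "cauchy_completion V = \<lparr>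
     carr = cauchy_seqs V // null_rel V,
     add = (\<lambda>X Y. \<Union>s\<in>X. \<Union>t\<in>Y. null_rel V `` {\<lambda>n. add V (s n) (t n)}),
     scl = (\<lambda>c X. \<Union>s\<in>X. null_rel V `` {\<lambda>n. scl V c (s n)}),
     zer = null_rel V `` {\<lambda>n. zer V},
     nrm = (\<lambda>X. THE r. \<forall>s\<in>X. (\<lambda>n. nrm V (s n)) \<longlonglongrightarrow> r) \<rparr>"

definition to_completion :: "('v, 'm) cspace_scheme \<Rightarrow> 'v \<Rightarrow> (nat \<Rightarrow> 'v) set" where
  "to_completion V x = null_rel V `` {\<lambda>n. x}"

definition complete_space :: "('v, 'm) cspace_scheme \<Rightarrow> bool" where
  "complete_space V \<longleftrightarrow> (\<forall>s\<in>cauchy_seqs V. \<exists>x\<in>carr V. (\<lambda>n. dst V (s n) x) \<longlonglongrightarrow> 0)"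

context cnormed_space
begin

lemma scl_0: "x \<in> carr V \<Longrightarrow> scl V 0 x = zer V"
  using scl_add_left[of x 1 "-1"] by (simp add: scl_one add_neg)

lemma nrm_zer: "nrm V (zer V) = 0"
  using nrm_scl[OF zer_closed, of 0] by (simp add: scl_0 zer_closed)

lemma nrm_neg: "x \<in> carr V \<Longrightarrow> nrm V (scl V (- 1) x) = nrm V x"
  by (simp add: nrm_scl)

lemma nrm_nonneg: "x \<in> carr V \<Longrightarrow> 0 \<le> nrm V x"
  using nrm_triangle[of x "scl V (-1) x"] by (simp add: add_neg nrm_zer nrm_neg scl_closed)

lemma add_4:
  assumes "x \<in> carr V" "y \<in> carr V" "z \<in> carr V" "w \<in> carr V"
  shows "add V (add V x y) (add V z w) = add V (add V x z) (add V y w)"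
  using assms by (metis add_assoc add_comm add_closed)

lemma dst_nonneg: "x \<in> carr V \<Longrightarrow> y \<in> carr V \<Longrightarrow> 0 \<le> dst V x y"
  by (simp add: dst_def nrm_nonneg add_closed scl_closed)

lemma dst_self: "x \<in> carr V \<Longrightarrow> dst V x x = 0"
  by (simp add: dst_def add_neg nrm_zer)

lemma dst_commute:
  assumes "x \<in> carr V" "y \<in> carr V" shows "dst V x y = dst V y x"
proof -
  have "add V y (scl V (-1) x) = scl V (-1) (add V x (scl V (-1) y))"
    using assms by (simp add: scl_add_right scl_closed scl_scl scl_one add_comm)
  then show ?thesis using assms by (simp add: dst_def nrm_neg add_closed scl_closed)
qed

lemma dst_triangle:
  assumes "x \<in> carr V" "y \<in> carr V" "z \<in> carr V"
  shows "dst V x z \<le> dst V x y + dst V y z"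
proof -
  have "add V (add V x (scl V (-1) y)) (add V y (scl V (-1) z))
      = add V (add V x (add V (scl V (-1) y) y)) (scl V (-1) z)"
    using assms by (simp add: add_assoc add_closed scl_closed)
  also have "\<dots> = add V x (scl V (-1) z)"
    using assms by (simp add: add_comm[of "scl V (-1) y" y] scl_closed add_neg add_zer)
  finally show ?thesis
    using nrm_triangle[of "add V x (scl V (-1) y)" "add V y (scl V (-1) z)"] assms
    by (simp add: dst_def add_closed scl_closed)
qed

lemma dst_add:
  assumes "x \<in> carr V" "y \<in> carr V" "z \<in> carr V" "w \<in> carr V"
  shows "dst V (add V x y) (add V z w) \<le> dst V x z + dst V y w"
  using assms nrm_triangle[of "add V x (scl V (-1) z)" "add V y (scl V (-1) w)"]
  by (simp add: dst_def scl_add_right add_4[of x y] add_closed scl_closed)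

lemma dst_scl:
  assumes "x \<in> carr V" "y \<in> carr V"
  shows "dst V (scl V c x) (scl V c y) = cmod c * dst V x y"
proof -
  have "add V (scl V c x) (scl V (-1) (scl V c y)) = scl V c (add V x (scl V (-1) y))"
    using assms by (simp add: scl_add_right scl_closed scl_scl)
  then show ?thesis using assms by (simp add: dst_def nrm_scl add_closed scl_closed)
qed

lemma dst_zer: "x \<in> carr V \<Longrightarrow> dst V x (zer V) = nrm V x"
  using scl_scl[OF zer_closed, of "-1" 0]
  by (simp add: dst_def scl_0 zer_closed add_zer)

lemma dst_eq_0:
  assumes "x \<in> carr V" "y \<in> carr V" "dst V x y = 0" shows "x = y"
proof -
  have "add V x (scl V (-1) y) = zer V"
    using assms by (intro nrm_eq_0) (auto simp: dst_def add_closed scl_closed)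
  then have "add V (add V x (scl V (-1) y)) y = y"
    using assms add_comm[OF zer_closed] by (simp add: add_zer zer_closed)
  then show ?thesis
    using assms
    by (simp add: add_assoc add_comm[of "scl V (-1) y" y] scl_closed add_neg add_zer)
qed

lemma nrm_diff:
  assumes "x \<in> carr V" "y \<in> carr V" shows "\<bar>nrm V x - nrm V y\<bar> \<le> dst V x y"
  using dst_triangle[of x y "zer V"] dst_triangle[of y x "zer V"] assms
  by (simp add: dst_zer zer_closed dst_commute[of y x])

lemma cauchy_carr: "s \<in> cauchy_seqs V \<Longrightarrow> s n \<in> carr V"
  by (simp add: cauchy_seqs_def)

lemma cauchyD: "s \<in> cauchy_seqs V \<Longrightarrow> 0 < e \<Longrightarrow> \<exists>N. \<forall>m\<ge>N. \<forall>n\<ge>N. dst V (s m) (s n) < e"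
  by (auto simp: cauchy_seqs_def)

lemma cauchyI:
  "(\<And>n. s n \<in> carr V) \<Longrightarrow> (\<And>e. 0 < e \<Longrightarrow> \<exists>N. \<forall>m\<ge>N. \<forall>n\<ge>N. dst V (s m) (s n) < e)
    \<Longrightarrow> s \<in> cauchy_seqs V"
  by (auto simp: cauchy_seqs_def)

lemma cauchy_const: "x \<in> carr V \<Longrightarrow> (\<lambda>n. x) \<in> cauchy_seqs V"
  by (rule cauchyI) (auto simp: dst_self)

lemma cauchy_add:
  assumes "s \<in> cauchy_seqs V" "t \<in> cauchy_seqs V"
  shows "(\<lambda>n. add V (s n) (t n)) \<in> cauchy_seqs V"
proof (rule cauchyI)
  fix e :: real assume e: "0 < e"
  obtain M N where MN: "\<forall>m\<ge>M. \<forall>n\<ge>M. dst V (s m) (s n) < e/2" "\<forall>m\<ge>N. \<forall>n\<ge>N. dst V (t m) (t n) < e/2"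
    using cauchyD[OF assms(1), of "e/2"] cauchyD[OF assms(2), of "e/2"] e by auto
  show "\<exists>N. \<forall>m\<ge>N. \<forall>n\<ge>N. dst V (add V (s m) (t m)) (add V (s n) (t n)) < e"
  proof (intro exI[of _ "max M N"] allI impI)
    fix m n assume mn: "max M N \<le> m" "max M N \<le> n"
    then have "dst V (s m) (s n) < e/2" "dst V (t m) (t n) < e/2" using MN by auto
    then show "dst V (add V (s m) (t m)) (add V (s n) (t n)) < e"
      using dst_add[of "s m" "t m" "s n" "t n"] assms by (simp add: cauchy_carr)
  qed
qed (use assms in \<open>simp add: cauchy_carr add_closed\<close>)

lemma cauchy_scl:
  assumes "s \<in> cauchy_seqs V" shows "(\<lambda>n. scl V c (s n)) \<in> cauchy_seqs V"
proof (rule cauchyI)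
  fix e :: real assume e: "0 < e"
  have pos: "0 < cmod c + 1" by (simp add: add_nonneg_pos)
  obtain N where N: "\<forall>m\<ge>N. \<forall>n\<ge>N. dst V (s m) (s n) < e / (cmod c + 1)"
    using cauchyD[OF assms, of "e / (cmod c + 1)"] e pos by auto
  show "\<exists>N. \<forall>m\<ge>N. \<forall>n\<ge>N. dst V (scl V c (s m)) (scl V c (s n)) < e"
  proof (intro exI[of _ N] allI impI)
    fix m n assume "N \<le> m" "N \<le> n"
    then have "(cmod c + 1) * dst V (s m) (s n) < e"
      using N pos by (simp add: pos_less_divide_eq mult.commute)
    moreover have "0 \<le> dst V (s m) (s n)" using assms by (simp add: dst_nonneg cauchy_carr)
    ultimately show "dst V (scl V c (s m)) (scl V c (s n)) < e"
      using assms by (simp add: dst_scl cauchy_carr algebra_simps)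
  qed
qed (use assms in \<open>simp add: cauchy_carr scl_closed\<close>)

lemma nrm_convergent:
  assumes "s \<in> cauchy_seqs V" shows "convergent (\<lambda>n. nrm V (s n))"
proof -
  have "Cauchy (\<lambda>n. nrm V (s n))"
  proof (rule metric_CauchyI)
    fix e :: real assume "0 < e"
    then obtain N where N: "\<forall>m\<ge>N. \<forall>n\<ge>N. dst V (s m) (s n) < e" using cauchyD[OF assms] by blast
    show "\<exists>M. \<forall>m\<ge>M. \<forall>n\<ge>M. dist (nrm V (s m)) (nrm V (s n)) < e"
    proof (intro exI[of _ N] allI impI)
      fix m n assume "N \<le> m" "N \<le> n"
      then show "dist (nrm V (s m)) (nrm V (s n)) < e"
        using N nrm_diff[of "s m" "s n"] assms
        by (force simp: dist_real_def cauchy_carr)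
    qed
  qed
  then show ?thesis by (simp add: Cauchy_convergent_iff)
qed

lemma null_relI:
  assumes "s \<in> cauchy_seqs V" "t \<in> cauchy_seqs V" "f \<longlonglongrightarrow> 0" "\<And>n. dst V (s n) (t n) \<le> f n"
  shows "(s, t) \<in> null_rel V"
  using assms tendsto_sandwich[of "\<lambda>_. 0" "\<lambda>n. dst V (s n) (t n)" sequentially f 0]
  by (auto simp: null_rel_def dst_nonneg cauchy_carr)

lemma null_rel_refl: "s \<in> cauchy_seqs V \<Longrightarrow> (s, s) \<in> null_rel V"
  by (simp add: null_rel_def dst_self cauchy_carr)

lemma null_relD:
  assumes "(s, t) \<in> null_rel V"
  shows "s \<in> cauchy_seqs V" "t \<in> cauchy_seqs V" "(\<lambda>n. dst V (s n) (t n)) \<longlonglongrightarrow> 0"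
  using assms by (auto simp: null_rel_def)

lemma equiv_null_rel: "equiv (cauchy_seqs V) (null_rel V)"
proof (rule equivI)
  show "null_rel V \<subseteq> cauchy_seqs V \<times> cauchy_seqs V" by (auto simp: null_rel_def)
  show "refl_on (cauchy_seqs V) (null_rel V)"
    by (auto simp: refl_on_def null_rel_refl)
  show "sym (null_rel V)"
    by (auto simp: sym_def null_rel_def dst_commute cauchy_carr)
  show "trans (null_rel V)"
  proof (rule transI)
    fix s t u assume st: "(s, t) \<in> null_rel V" and tu: "(t, u) \<in> null_rel V"
    show "(s, u) \<in> null_rel V"
      using tendsto_add[OF null_relD(3)[OF st] null_relD(3)[OF tu]] null_relD[OF st] null_relD[OF tu]
      by (intro null_relI[where f = "\<lambda>n. dst V (s n) (t n) + dst V (t n) (u n)"])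
         (auto simp: dst_triangle cauchy_carr)
  qed
qed

abbreviation cls where "cls s \<equiv> null_rel V `` {s}"

lemma cls_carr: "s \<in> cauchy_seqs V \<Longrightarrow> cls s \<in> carr (cauchy_completion V)"
  by (simp add: cauchy_completion_def quotientI)

lemma cls_cases:
  assumes "X \<in> carr (cauchy_completion V)" obtains s where "s \<in> cauchy_seqs V" "X = cls s"
  using assms by (auto simp: cauchy_completion_def elim: quotientE)

lemma cls_eq_iff: "s \<in> cauchy_seqs V \<Longrightarrow> t \<in> cauchy_seqs V \<Longrightarrow> cls s = cls t \<longleftrightarrow> (s, t) \<in> null_rel V"
  by (rule eq_equiv_class_iff[OF equiv_null_rel])

lemma completion_scl:
  assumes "s \<in> cauchy_seqs V"
  shows "scl (cauchy_completion V) c (cls s) = cls (\<lambda>n. scl V c (s n))"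
proof -
  have "(\<lambda>s. cls (\<lambda>n. scl V c (s n))) respects null_rel V"
  proof (rule congruentI)
    fix s t assume st: "(s, t) \<in> null_rel V"
    show "cls (\<lambda>n. scl V c (s n)) = cls (\<lambda>n. scl V c (t n))"
      using null_relD[OF st] tendsto_mult_left[OF null_relD(3)[OF st], of "cmod c"]
      by (subst cls_eq_iff)
         (auto intro!: null_relI[where f = "\<lambda>n. cmod c * dst V (s n) (t n)"]
               simp: cauchy_scl dst_scl cauchy_carr)
  qed
  then show ?thesis
    using UN_equiv_class[OF equiv_null_rel _ assms, of "\<lambda>s. cls (\<lambda>n. scl V c (s n))"]
    by (simp add: cauchy_completion_def)
qed

lemma completion_add:
  assumes "s \<in> cauchy_seqs V" "t \<in> cauchy_seqs V"
  shows "add (cauchy_completion V) (cls s) (cls t) = cls (\<lambda>n. add V (s n) (t n))"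
proof -
  have "(\<lambda>s t. cls (\<lambda>n. add V (s n) (t n))) respects2 null_rel V"
  proof (rule congruent2I'[OF _])
    fix s s' t t' assume s: "(s, s') \<in> null_rel V" and t: "(t, t') \<in> null_rel V"
    show "cls (\<lambda>n. add V (s n) (t n)) = cls (\<lambda>n. add V (s' n) (t' n))"
      using null_relD[OF s] null_relD[OF t] tendsto_add[OF null_relD(3)[OF s] null_relD(3)[OF t]]
      by (subst cls_eq_iff)
         (auto intro!: null_relI[where f = "\<lambda>n. dst V (s n) (s' n) + dst V (t n) (t' n)"]
               simp: cauchy_add dst_add cauchy_carr)
  qed
  then show ?thesis
    using UN_equiv_class2[OF equiv_null_rel equiv_null_rel _ assms, of "\<lambda>s t. cls (\<lambda>n. add V (s n) (t n))"]
    by (simp add: cauchy_completion_def)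
qed

lemma completion_nrm:
  assumes "s \<in> cauchy_seqs V"
  shows "(\<lambda>n. nrm V (s n)) \<longlonglongrightarrow> nrm (cauchy_completion V) (cls s)"
proof -
  obtain r where r: "(\<lambda>n. nrm V (s n)) \<longlonglongrightarrow> r"
    using nrm_convergent[OF assms] by (auto simp: convergent_def)
  have all: "\<forall>t\<in>cls s. (\<lambda>n. nrm V (t n)) \<longlonglongrightarrow> r"
  proof
    fix t assume "t \<in> cls s"
    then have st: "(s, t) \<in> null_rel V" by simp
    have "(\<lambda>n. nrm V (s n) - nrm V (t n)) \<longlonglongrightarrow> 0"
      by (rule Lim_null_comparison[OF _ null_relD(3)[OF st]])
         (use null_relD[OF st] in \<open>auto simp: nrm_diff cauchy_carr\<close>)
    from tendsto_diff[OF r this] show "(\<lambda>n. nrm V (t n)) \<longlonglongrightarrow> r" by simp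
  qed
  have "nrm (cauchy_completion V) (cls s) = r"
    unfolding cauchy_completion_def using all null_rel_refl[OF assms]
    by (auto intro!: the_equality intro: LIMSEQ_unique)
  then show ?thesis using r by simp
qed

theorem cnormed_space_completion: "cnormed_space (cauchy_completion V)"
proof
  show "zer (cauchy_completion V) \<in> carr (cauchy_completion V)"
    using cls_carr[OF cauchy_const[OF zer_closed]] by (simp add: cauchy_completion_def)
next
  fix X Y assume "X \<in> carr (cauchy_completion V)" "Y \<in> carr (cauchy_completion V)"
  then obtain s t where [simp]: "s \<in> cauchy_seqs V" "X = cls s" "t \<in> cauchy_seqs V" "Y = cls t"
    by (metis cls_cases)
  show "add (cauchy_completion V) X Y \<in> carr (cauchy_completion V)"
    by (simp add: completion_add cls_carr cauchy_add)
  show "add (cauchy_completion V) X Y = add (cauchy_completion V) Y X"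
    by (simp add: completion_add add_comm cauchy_carr)
  show "scl (cauchy_completion V) c (add (cauchy_completion V) X Y)
      = add (cauchy_completion V) (scl (cauchy_completion V) c X) (scl (cauchy_completion V) c Y)" for c
    by (simp add: completion_add completion_scl cauchy_add cauchy_scl scl_add_right cauchy_carr)
  show "nrm (cauchy_completion V) (add (cauchy_completion V) X Y) \<le> nrm (cauchy_completion V) X + nrm (cauchy_completion V) Y"
    using LIMSEQ_le[OF completion_nrm[OF cauchy_add]
        tendsto_add[OF completion_nrm completion_nrm], of s t s t]
    by (simp add: completion_add nrm_triangle cauchy_carr)
next
  fix X Y Z assume "X \<in> carr (cauchy_completion V)" "Y \<in> carr (cauchy_completion V)" "Z \<in> carr (cauchy_completion V)"
  then obtain s t u where [simp]: "s \<in> cauchy_seqs V" "X = cls s" "t \<in> cauchy_seqs V" "Y = cls t"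
    "u \<in> cauchy_seqs V" "Z = cls u"
    by (metis cls_cases)
  show "add (cauchy_completion V) (add (cauchy_completion V) X Y) Z = add (cauchy_completion V) X (add (cauchy_completion V) Y Z)"
    by (simp add: completion_add cauchy_add add_assoc cauchy_carr)
next
  fix X c d assume "X \<in> carr (cauchy_completion V)"
  then obtain s where [simp]: "s \<in> cauchy_seqs V" "X = cls s" by (metis cls_cases)
  have z: "zer (cauchy_completion V) = cls (\<lambda>n. zer V)" by (simp add: cauchy_completion_def)
  show "scl (cauchy_completion V) c X \<in> carr (cauchy_completion V)"
    by (simp add: completion_scl cls_carr cauchy_scl)
  show "add (cauchy_completion V) X (zer (cauchy_completion V)) = X"
    by (simp add: z completion_add cauchy_const zer_closed add_zer cauchy_carr)
  show "add (cauchy_completion V) X (scl (cauchy_completion V) (- 1) X) = zer (cauchy_completion V)"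
    by (simp add: z completion_add completion_scl cauchy_scl add_neg cauchy_carr)
  show "scl (cauchy_completion V) 1 X = X"
    by (simp add: completion_scl scl_one cauchy_carr)
  show "scl (cauchy_completion V) c (scl (cauchy_completion V) d X) = scl (cauchy_completion V) (c * d) X"
    by (simp add: completion_scl cauchy_scl scl_scl cauchy_carr)
  show "scl (cauchy_completion V) (c + d) X = add (cauchy_completion V) (scl (cauchy_completion V) c X) (scl (cauchy_completion V) d X)"
    by (simp add: completion_scl completion_add cauchy_scl scl_add_left cauchy_carr)
  show "nrm (cauchy_completion V) (scl (cauchy_completion V) c X) = cmod c * nrm (cauchy_completion V) X"
    using completion_nrm[OF cauchy_scl, of s c] tendsto_mult_left[OF completion_nrm, of s "cmod c"]
    by (simp add: completion_scl nrm_scl cauchy_carr LIMSEQ_unique)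
  show "X = zer (cauchy_completion V)" if "nrm (cauchy_completion V) X = 0"
  proof -
    have "(s, \<lambda>n. zer V) \<in> null_rel V"
      using completion_nrm[of s] that
      by (simp add: null_rel_def cauchy_const zer_closed dst_zer cauchy_carr)
    then show ?thesis by (simp add: z cls_eq_iff cauchy_const zer_closed del: Image_singleton_iff)
  qed
qed

lemma completion_dst:
  assumes "s \<in> cauchy_seqs V" "t \<in> cauchy_seqs V"
  shows "(\<lambda>n. dst V (s n) (t n)) \<longlonglongrightarrow> dst (cauchy_completion V) (cls s) (cls t)"
  using completion_nrm[OF cauchy_add[OF assms(1) cauchy_scl[OF assms(2), of "-1"]]] assms
  by (simp add: dst_def completion_add completion_scl cauchy_scl)

lemma embed_carr: "x \<in> carr V \<Longrightarrow> to_completion V x \<in> carr (cauchy_completion V)"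
  by (simp add: to_completion_def cls_carr cauchy_const)

theorem embed_linear: "linear_op V (cauchy_completion V) (to_completion V)"
  by (simp add: linear_op_def embed_carr)
     (simp add: to_completion_def completion_add completion_scl cauchy_const)

theorem embed_isometric: "x \<in> carr V \<Longrightarrow> nrm (cauchy_completion V) (to_completion V x) = nrm V x"
  using completion_nrm[OF cauchy_const] LIMSEQ_unique[OF _ tendsto_const] by (metis to_completion_def)

theorem embed_dense:
  assumes "X \<in> carr (cauchy_completion V)" "0 < e"
  shows "\<exists>x\<in>carr V. dst (cauchy_completion V) X (to_completion V x) < e"
proof -
  obtain s where s: "s \<in> cauchy_seqs V" "X = cls s" using assms(1) by (metis cls_cases)
  obtain N where N: "\<forall>m\<ge>N. \<forall>n\<ge>N. dst V (s m) (s n) < e/2"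
    using cauchyD[OF s(1), of "e/2"] assms(2) by auto
  have "dst (cauchy_completion V) X (to_completion V (s N)) \<le> e/2"
    unfolding s(2) to_completion_def
    by (rule Lim_bounded[OF completion_dst[OF s(1) cauchy_const[OF cauchy_carr[OF s(1)]]], of N])
       (use N in \<open>auto intro: less_imp_le\<close>)
  then show ?thesis using assms(2) cauchy_carr[OF s(1), of N] by (intro bexI[of _ "s N"]) auto
qed

theorem complete_completion: "complete_space (cauchy_completion V)"
  unfolding complete_space_def
proof
  interpret C: cnormed_space "cauchy_completion V" by (rule cnormed_space_completion)
  fix X assume X: "X \<in> cauchy_seqs (cauchy_completion V)"
  note Xc = C.cauchy_carr[OF X]
  have "\<exists>x. x \<in> carr V \<and> dst (cauchy_completion V) (X k) (to_completion V x) < 1 / real (Suc k)" for k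
    using embed_dense[OF Xc, of "1 / real (Suc k)" k] by auto
  then obtain t where t: "\<And>k. t k \<in> carr V"
      "\<And>k. dst (cauchy_completion V) (X k) (to_completion V (t k)) < 1 / real (Suc k)" by metis
  have iso: "dst (cauchy_completion V) (to_completion V x) (to_completion V y) = dst V x y"
    if "x \<in> carr V" "y \<in> carr V" for x y
    using completion_dst[OF cauchy_const cauchy_const, of x y] that
      LIMSEQ_unique[OF _ tendsto_const] by (metis to_completion_def)
  have tC: "t \<in> cauchy_seqs V"
  proof (rule cauchyI)
    fix e :: real assume e: "0 < e"
    obtain M where M: "\<forall>m\<ge>M. \<forall>n\<ge>M. dst (cauchy_completion V) (X m) (X n) < e/3"
      using C.cauchyD[OF X, of "e/3"] e by auto
    obtain K where K: "1 / real (Suc K) < e/3" using e nat_approx_posE[of "e/3"] by auto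
    show "\<exists>N. \<forall>m\<ge>N. \<forall>n\<ge>N. dst V (t m) (t n) < e"
    proof (intro exI[of _ "max M K"] allI impI)
      fix m n assume mn: "max M K \<le> m" "max M K \<le> n"
      have b: "dst (cauchy_completion V) (X k) (to_completion V (t k)) < e/3" if "K \<le> k" for k
      proof -
        have "1 / real (Suc k) \<le> 1 / real (Suc K)" using that by (simp add: frac_le)
        then show ?thesis using t(2)[of k] K by linarith
      qed
      have "dst V (t m) (t n) = dst (cauchy_completion V) (to_completion V (t m)) (to_completion V (t n))"
        by (simp add: iso t(1))
      also have "\<dots> \<le> dst (cauchy_completion V) (to_completion V (t m)) (X m)
          + (dst (cauchy_completion V) (X m) (X n) + dst (cauchy_completion V) (X n) (to_completion V (t n)))"
        using C.dst_triangle[of "to_completion V (t m)" "X m" "to_completion V (t n)"]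
          C.dst_triangle[of "X m" "X n" "to_completion V (t n)"] Xc t(1) by (simp add: embed_carr)
      also have "\<dots> < e"
      proof -
        have "dst (cauchy_completion V) (X m) (X n) < e/3" using M mn by simp
        then show ?thesis
          using mn b[of m] b[of n] C.dst_commute[OF embed_carr[OF t(1)[of m]] Xc[of m]] by simp
      qed
      finally show "dst V (t m) (t n) < e" .
    qed
  qed (use t in simp)
  have lim: "(\<lambda>k. dst (cauchy_completion V) (to_completion V (t k)) (cls t)) \<longlonglongrightarrow> 0"
  proof (rule LIMSEQ_I)
    fix r :: real assume r: "0 < r"
    obtain N where N: "\<forall>m\<ge>N. \<forall>n\<ge>N. dst V (t m) (t n) < r/2"
      using cauchyD[OF tC, of "r/2"] r by auto
    have "dst (cauchy_completion V) (to_completion V (t k)) (cls t) \<le> r/2" if "N \<le> k" for k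
      unfolding to_completion_def
      by (rule Lim_bounded[OF completion_dst[OF cauchy_const[OF t(1)] tC], of N])
         (use N that in \<open>auto intro: less_imp_le\<close>)
    then show "\<exists>no. \<forall>n\<ge>no. norm (dst (cauchy_completion V) (to_completion V (t n)) (cls t) - 0) < r"
      using r C.dst_nonneg[OF embed_carr[OF t(1)] cls_carr[OF tC]]
      by (intro exI[of _ N]) (force simp: abs_of_nonneg)
  qed
  have "(\<lambda>k. dst (cauchy_completion V) (X k) (cls t)) \<longlonglongrightarrow> 0"
  proof (rule tendsto_sandwich[OF _ _ tendsto_const])
    show "\<forall>\<^sub>F k in sequentially. 0 \<le> dst (cauchy_completion V) (X k) (cls t)"
      by (simp add: C.dst_nonneg Xc cls_carr tC)
    show "\<forall>\<^sub>F k in sequentially. dst (cauchy_completion V) (X k) (cls t)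
        \<le> 1 / real (Suc k) + dst (cauchy_completion V) (to_completion V (t k)) (cls t)"
      using C.dst_triangle[OF Xc embed_carr[OF t(1)] cls_carr[OF tC]] t(2)
      by (intro always_eventually allI) (smt (verit))
    show "(\<lambda>k. 1 / real (Suc k) + dst (cauchy_completion V) (to_completion V (t k)) (cls t)) \<longlonglongrightarrow> 0"
      using tendsto_add[OF LIMSEQ_inverse_real_of_nat lim] by (simp add: inverse_eq_divide)
  qed
  then show "\<exists>x\<in>carr (cauchy_completion V). (\<lambda>n. dst (cauchy_completion V) (X n) x) \<longlonglongrightarrow> 0"
    using cls_carr[OF tC] by blast
qed

end


section \<open>The function spaces\<close>

text \<open>
  A function on a subset of the reals is represented by its extension by zero to the whole line.
  The derivative on \<open>[a, b]\<close> is one-sided at the end points.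
\<close>

definition deriv_on :: "real \<Rightarrow> real \<Rightarrow> (real \<Rightarrow> complex) \<Rightarrow> real \<Rightarrow> complex" where
  "deriv_on a b u x = vector_derivative u (at x within {a..b})"

definition C1 :: "real \<Rightarrow> real \<Rightarrow> (real \<Rightarrow> complex) cspace" where
  "C1 a b = \<lparr>
     carr = {u. (\<forall>x. x \<notin> {a..b} \<longrightarrow> u x = 0) \<and>
                (\<forall>x\<in>{a..b}. u differentiable (at x within {a..b})) \<and>
                continuous_on {a..b} (deriv_on a b u)},
     add = (\<lambda>u v x. u x + v x),
     scl = (\<lambda>c u x. c * u x),
     zer = (\<lambda>x. 0),
     nrm = (\<lambda>u. sqrt (integral {a..b} (\<lambda>x. (cmod (u x))\<^sup>2)
                     + integral {a..b} (\<lambda>x. (cmod (deriv_on a b u x))\<^sup>2))) \<rparr>"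

definition H1 :: "real \<Rightarrow> real \<Rightarrow> (nat \<Rightarrow> real \<Rightarrow> complex) set cspace" where
  "H1 a b = cauchy_completion (C1 a b)"

definition L2_ends :: "real \<Rightarrow> real \<Rightarrow> (real \<Rightarrow> complex) cspace" where
  "L2_ends a b = \<lparr>
     carr = {\<phi>. \<forall>x. x \<notin> {a, b} \<longrightarrow> \<phi> x = 0},
     add = (\<lambda>\<phi> \<psi> x. \<phi> x + \<psi> x),
     scl = (\<lambda>c \<phi> x. c * \<phi> x),
     zer = (\<lambda>x. 0),
     nrm = (\<lambda>\<phi>. sqrt ((cmod (\<phi> a))\<^sup>2 + (cmod (\<phi> b))\<^sup>2)) \<rparr>"

definition restr_ends :: "real \<Rightarrow> real \<Rightarrow> (real \<Rightarrow> complex) \<Rightarrow> real \<Rightarrow> complex" where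
  "restr_ends a b u = (\<lambda>x. if x \<in> {a, b} then u x else 0)"

lemma linear_restr_ends: "linear_op (C1 a b) (L2_ends a b) (restr_ends a b)"
  by (auto simp: linear_op_def C1_def L2_ends_def restr_ends_def)

lemma cnormed_space_L2_ends: "cnormed_space (L2_ends a b)"
proof
  fix \<phi> \<psi> :: "real \<Rightarrow> complex" and c :: complex
  show "nrm (L2_ends a b) (add (L2_ends a b) \<phi> \<psi>) \<le> nrm (L2_ends a b) \<phi> + nrm (L2_ends a b) \<psi>"
    using norm_triangle_ineq[of "(\<phi> a, \<phi> b)" "(\<psi> a, \<psi> b)"] by (simp add: L2_ends_def norm_Pair)
  show "nrm (L2_ends a b) (scl (L2_ends a b) c \<phi>) = cmod c * nrm (L2_ends a b) \<phi>"
    by (simp add: L2_ends_def norm_mult power_mult_distrib flip: distrib_left)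
       (simp add: real_sqrt_mult)
  show "\<phi> = zer (L2_ends a b)" if "\<phi> \<in> carr (L2_ends a b)" "nrm (L2_ends a b) \<phi> = 0"
    using that by (auto simp: L2_ends_def fun_eq_iff add_nonneg_eq_0_iff)
qed (auto simp: L2_ends_def algebra_simps)

lemma C1_has_deriv:
  assumes "u \<in> carr (C1 a b)" "x \<in> {a..b}"
  shows "(u has_vector_derivative deriv_on a b u x) (at x within {a..b})"
  using assms by (simp add: C1_def deriv_on_def flip: vector_derivative_works)

lemma C1_continuous: "u \<in> carr (C1 a b) \<Longrightarrow> continuous_on {a..b} u"
  by (meson C1_has_deriv continuous_on_eq_continuous_within has_vector_derivative_continuous)

lemma C1_deriv_continuous: "u \<in> carr (C1 a b) \<Longrightarrow> continuous_on {a..b} (deriv_on a b u)"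
  by (simp add: C1_def)

lemma deriv_on_eq:
  assumes "a < b" "x \<in> {a..b}" "(u has_vector_derivative d) (at x within {a..b})"
  shows "deriv_on a b u x = d"
  unfolding deriv_on_def using assms vector_derivative_within_cbox[of a b x u d] by simp

lemma C1_I:
  assumes "a < b" "\<And>x. x \<notin> {a..b} \<Longrightarrow> u x = 0"
    "\<And>x. x \<in> {a..b} \<Longrightarrow> (u has_vector_derivative d x) (at x within {a..b})" "continuous_on {a..b} d"
  shows "u \<in> carr (C1 a b)"
proof -
  have "continuous_on {a..b} (deriv_on a b u)"
    using assms(4) by (rule continuous_on_eq) (use deriv_on_eq assms in metis)
  then show ?thesis
    using assms(2) differentiableI_vector[OF assms(3)] unfolding C1_def by simp
qed

lemma deriv_on_add:
  assumes "a < b" "u \<in> carr (C1 a b)" "v \<in> carr (C1 a b)" "x \<in> {a..b}"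
  shows "deriv_on a b (\<lambda>x. u x + v x) x = deriv_on a b u x + deriv_on a b v x"
  using assms by (intro deriv_on_eq has_vector_derivative_add C1_has_deriv)

lemma deriv_on_scl:
  assumes "a < b" "u \<in> carr (C1 a b)" "x \<in> {a..b}"
  shows "deriv_on a b (\<lambda>x. c * u x) x = c * deriv_on a b u x"
  using assms by (intro deriv_on_eq has_vector_derivative_mult_right C1_has_deriv)

lemma C1_nrm_sq:
  "(nrm (C1 a b) u)\<^sup>2 = integral {a..b} (\<lambda>x. (cmod (u x))\<^sup>2)
     + integral {a..b} (\<lambda>x. (cmod (deriv_on a b u x))\<^sup>2)"
proof -
  have "0 \<le> integral {a..b} (\<lambda>x. (cmod (f x))\<^sup>2)" for f
    by (cases "(\<lambda>x. (cmod (f x))\<^sup>2) integrable_on {a..b}")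
       (auto intro: integral_nonneg simp: not_integrable_integral)
  then show ?thesis by (simp add: C1_def)
qed

lemma C1_nrm_nonneg: "0 \<le> nrm (C1 a b) u"
proof -
  have "0 \<le> integral {a..b} (\<lambda>x. (cmod (f x))\<^sup>2)" for f
    by (cases "(\<lambda>x. (cmod (f x))\<^sup>2) integrable_on {a..b}")
       (auto intro: integral_nonneg simp: not_integrable_integral)
  then show ?thesis by (simp add: C1_def)
qed

lemma C1_integrable:
  assumes "u \<in> carr (C1 a b)"
  shows "(\<lambda>x. (cmod (u x))\<^sup>2) integrable_on {a..b}"
    "(\<lambda>x. (cmod (deriv_on a b u x))\<^sup>2) integrable_on {a..b}"
  by (intro integrable_continuous_real continuous_intros C1_continuous C1_deriv_continuous assms)+

lemma C1_nrm_eq_0: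
  assumes "a < b" "u \<in> carr (C1 a b)" "nrm (C1 a b) u = 0"
  shows "u = (\<lambda>x. 0)"
proof -
  have nn: "0 \<le> integral {a..b} (\<lambda>x. (cmod (u x))\<^sup>2)"
    "0 \<le> integral {a..b} (\<lambda>x. (cmod (deriv_on a b u x))\<^sup>2)"
    by (intro integral_nonneg C1_integrable assms; simp)+
  then have "integral {a..b} (\<lambda>x. (cmod (u x))\<^sup>2) = 0"
    using C1_nrm_sq[of a b u] assms(3) by simp
  then have "((\<lambda>x. (cmod (u x))\<^sup>2) has_integral 0) (cbox a b)"
    using C1_integrable(1)[OF assms(2)] by (simp add: has_integral_integrable_integral)
  then have "(cmod (u x))\<^sup>2 = 0" if "x \<in> {a..b}" for x
    using assms that
    by (intro has_integral_0_cbox_imp_0[of a b "\<lambda>x. (cmod (u x))\<^sup>2"])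
       (auto intro!: continuous_intros C1_continuous)
  moreover have "u x = 0" if "x \<notin> {a..b}" for x
    using assms(2) that by (simp add: C1_def)
  ultimately show ?thesis by (intro ext) (metis norm_eq_zero power_eq_0_iff)
qed

lemma cmod_add_sq_le:
  assumes "0 < t"
  shows "(cmod (x + y))\<^sup>2 \<le> (1 + t) * (cmod x)\<^sup>2 + (1 + 1/t) * (cmod y)\<^sup>2"
proof -
  have "(cmod (x + y))\<^sup>2 \<le> (cmod x + cmod y)\<^sup>2" by (simp add: norm_triangle_ineq power_mono)
  moreover have "0 \<le> (t * cmod x - cmod y)\<^sup>2 / t" using assms by simp
  moreover have "(t * cmod x - cmod y)\<^sup>2 / t = t * (cmod x)\<^sup>2 - 2 * cmod x * cmod y + (cmod y)\<^sup>2 / t"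
    using assms by (simp add: field_simps power2_eq_square)
  ultimately show ?thesis by (simp add: power2_sum algebra_simps)
qed

lemma C1_add_carr:
  assumes "a < b" "u \<in> carr (C1 a b)" "v \<in> carr (C1 a b)"
  shows "(\<lambda>x. u x + v x) \<in> carr (C1 a b)"
proof (rule C1_I[OF assms(1)])
  show "u x + v x = 0" if "x \<notin> {a..b}" for x
    using assms that by (simp add: C1_def)
  show "((\<lambda>x. u x + v x) has_vector_derivative deriv_on a b u x + deriv_on a b v x)
      (at x within {a..b})" if "x \<in> {a..b}" for x
    by (intro has_vector_derivative_add C1_has_deriv assms that)
  show "continuous_on {a..b} (\<lambda>x. deriv_on a b u x + deriv_on a b v x)"
    by (intro continuous_on_add C1_deriv_continuous assms)
qed

lemma C1_scl_carr:
  assumes "a < b" "u \<in> carr (C1 a b)"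
  shows "(\<lambda>x. c * u x) \<in> carr (C1 a b)"
proof (rule C1_I[OF assms(1)])
  show "c * u x = 0" if "x \<notin> {a..b}" for x
    using assms that by (simp add: C1_def)
  show "((\<lambda>x. c * u x) has_vector_derivative c * deriv_on a b u x) (at x within {a..b})"
    if "x \<in> {a..b}" for x
    by (intro has_vector_derivative_mult_right C1_has_deriv assms that)
  show "continuous_on {a..b} (\<lambda>x. c * deriv_on a b u x)"
    by (intro continuous_on_mult_left C1_deriv_continuous assms)
qed

lemma C1_nrm_triangle:
  assumes "a < b" "u \<in> carr (C1 a b)" "v \<in> carr (C1 a b)"
  shows "nrm (C1 a b) (\<lambda>x. u x + v x) \<le> nrm (C1 a b) u + nrm (C1 a b) v"
proof (cases "nrm (C1 a b) u = 0 \<or> nrm (C1 a b) v = 0")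
  case True
  then consider "u = (\<lambda>x. 0)" | "v = (\<lambda>x. 0)"
    using C1_nrm_eq_0[OF assms(1,2)] C1_nrm_eq_0[OF assms(1,3)] by blast
  then show ?thesis
    using C1_nrm_nonneg[of a b] by cases simp_all
next
  case False
  define A B where "A = nrm (C1 a b) u" and "B = nrm (C1 a b) v"
  have pos: "0 < A" "0 < B" using False C1_nrm_nonneg[of a b] by (auto simp: A_def B_def less_le)
  define t where "t = B / A"
  have t: "0 < t" using pos by (simp add: t_def)
  have le: "integral {a..b} (\<lambda>x. (cmod (f x + g x))\<^sup>2)
      \<le> (1 + t) * integral {a..b} (\<lambda>x. (cmod (f x))\<^sup>2) + (1 + 1/t) * integral {a..b} (\<lambda>x. (cmod (g x))\<^sup>2)"
    if fg: "continuous_on {a..b} f" "continuous_on {a..b} g" for f g :: "real \<Rightarrow> complex"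
  proof -
    have "integral {a..b} (\<lambda>x. (cmod (f x + g x))\<^sup>2)
        \<le> integral {a..b} (\<lambda>x. (1 + t) * (cmod (f x))\<^sup>2 + (1 + 1/t) * (cmod (g x))\<^sup>2)"
      by (intro integral_le integrable_continuous_real continuous_intros fg cmod_add_sq_le t)
    also have "\<dots> = (1 + t) * integral {a..b} (\<lambda>x. (cmod (f x))\<^sup>2)
        + (1 + 1/t) * integral {a..b} (\<lambda>x. (cmod (g x))\<^sup>2)"
      by (subst integral_add) (intro integrable_continuous_real continuous_intros fg | simp)+
    finally show ?thesis .
  qed
  have "(nrm (C1 a b) (\<lambda>x. u x + v x))\<^sup>2 = integral {a..b} (\<lambda>x. (cmod (u x + v x))\<^sup>2)
      + integral {a..b} (\<lambda>x. (cmod (deriv_on a b u x + deriv_on a b v x))\<^sup>2)"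
    unfolding C1_nrm_sq using assms by (auto simp: deriv_on_add intro!: integral_cong)
  also have "\<dots> \<le> (1 + t) * A\<^sup>2 + (1 + 1/t) * B\<^sup>2"
    using le[OF C1_continuous[OF assms(2)] C1_continuous[OF assms(3)]]
      le[OF C1_deriv_continuous[OF assms(2)] C1_deriv_continuous[OF assms(3)]]
    unfolding A_def B_def C1_nrm_sq by (simp add: algebra_simps)
  also have "\<dots> = (A + B)\<^sup>2"
    using pos by (simp add: t_def power2_eq_square field_simps)
  finally show ?thesis
    unfolding A_def[symmetric] B_def[symmetric] by (rule power2_le_imp_le) (use pos in simp)
qed

theorem cnormed_space_C1:
  assumes "a < b" shows "cnormed_space (C1 a b)"
proof
  show "zer (C1 a b) \<in> carr (C1 a b)"
    using C1_I[OF assms, of "\<lambda>_. 0" "\<lambda>_. 0"] by (simp add: C1_def)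
next
  fix u v assume uv: "u \<in> carr (C1 a b)" "v \<in> carr (C1 a b)"
  show "add (C1 a b) u v \<in> carr (C1 a b)"
    using C1_add_carr[OF assms uv] by (simp add: C1_def)
  show "nrm (C1 a b) (add (C1 a b) u v) \<le> nrm (C1 a b) u + nrm (C1 a b) v"
    using C1_nrm_triangle[OF assms uv] by (simp add: C1_def)
next
  fix u c assume u: "u \<in> carr (C1 a b)"
  show "scl (C1 a b) c u \<in> carr (C1 a b)"
    using C1_scl_carr[OF assms u] by (simp add: C1_def)
  show "u = zer (C1 a b)" if "nrm (C1 a b) u = 0"
    using C1_nrm_eq_0[OF assms u that] by (simp add: C1_def)
  have "integral {a..b} (\<lambda>x. (cmod (deriv_on a b (\<lambda>x. c * u x) x))\<^sup>2)
      = integral {a..b} (\<lambda>x. (cmod c)\<^sup>2 * (cmod (deriv_on a b u x))\<^sup>2)"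
    by (rule integral_cong) (simp add: deriv_on_scl assms u norm_mult power_mult_distrib)
  then have "(nrm (C1 a b) (\<lambda>x. c * u x))\<^sup>2 = (cmod c * nrm (C1 a b) u)\<^sup>2"
    by (simp add: C1_nrm_sq power_mult_distrib norm_mult distrib_left)
  then have "nrm (C1 a b) (\<lambda>x. c * u x) = cmod c * nrm (C1 a b) u"
    by (rule power2_eq_imp_eq) (auto simp: C1_nrm_nonneg)
  then show "nrm (C1 a b) (scl (C1 a b) c u) = cmod c * nrm (C1 a b) u"
    by (simp add: C1_def)
qed (auto simp: C1_def algebra_simps)

theorem H1_banach:
  assumes "a < b" shows "cnormed_space (H1 a b)" "complete_space (H1 a b)"
  unfolding H1_def
  by (intro cnormed_space.cnormed_space_completion cnormed_space.complete_completion
        cnormed_space_C1 assms)+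

end

theory Submission
  imports Defs
begin

text \<open>
  The operator exists because point evaluation at the end points is bounded for the \<open>H\<^sup>1\<close> norm on
  \<open>C\<^sup>1\<close> functions. Integrating the derivative of \<open>(x - m) |u(x)|\<^sup>2\<close> over \<open>[a, b]\<close>, with \<open>m\<close> the midpoint,
  produces \<open>(b - a)/2 (|u(a)|\<^sup>2 + |u(b)|\<^sup>2)\<close> on one side and, on the other, terms that are controlled
  by \<open>|u|\<^sup>2 + |u'|\<^sup>2\<close>; this is the trace inequality \<open>C1_trace_inequality\<close>.

  The rest is the extension principle \<open>bounded_extension_ex1\<close>: a bounded linear operator from a normed
  space \<open>V\<close> to a complete space maps Cauchy sequences to convergent ones and null sequences to null
  sequences, so it passes to the completion of \<open>V\<close>, and the extension is unique because \<open>V\<close> is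
  dense there. The target \<open>L\<^sup>2({a, b})\<close> is complete since it is just \<open>\<complex>\<^sup>2\<close>.
\<close>


section \<open>Limits in normed spaces on carriers\<close>

definition converges_to :: "('v, 'm) cspace_scheme \<Rightarrow> (nat \<Rightarrow> 'v) \<Rightarrow> 'v \<Rightarrow> bool" where
  "converges_to V s x \<longleftrightarrow> (\<forall>n. s n \<in> carr V) \<and> x \<in> carr V \<and> (\<lambda>n. dst V (s n) x) \<longlonglongrightarrow> 0"

context cnormed_space
begin

lemma converges_to_sandwich:
  assumes "\<And>n. s n \<in> carr V" "x \<in> carr V" "\<And>n. dst V (s n) x \<le> f n" "f \<longlonglongrightarrow> 0"
  shows "converges_to V s x"
  unfolding converges_to_def
  using assms tendsto_sandwich[of "\<lambda>_. 0" "\<lambda>n. dst V (s n) x" sequentially f 0]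
  by (auto simp: dst_nonneg)

lemma converges_to_const: "x \<in> carr V \<Longrightarrow> converges_to V (\<lambda>n. x) x"
  by (simp add: converges_to_def dst_self)

lemma converges_to_unique:
  assumes "converges_to V s x" "converges_to V s y" shows "x = y"
proof -
  note c = assms[unfolded converges_to_def]
  have "(\<lambda>n. dst V (s n) x + dst V (s n) y) \<longlonglongrightarrow> 0"
    using tendsto_add[of "\<lambda>n. dst V (s n) x" 0 sequentially "\<lambda>n. dst V (s n) y" 0] c by simp
  moreover have "dst V x y \<le> dst V (s n) x + dst V (s n) y" for n
    using dst_triangle[of x "s n" y] dst_commute[of x "s n"] c by simp
  ultimately have "dst V x y \<le> 0"
    by (intro LIMSEQ_le_const) auto
  then show ?thesis using c dst_eq_0 dst_nonneg by (metis antisym)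
qed

lemma converges_to_add:
  assumes "converges_to V s x" "converges_to V t y"
  shows "converges_to V (\<lambda>n. add V (s n) (t n)) (add V x y)"
proof -
  note c = assms[unfolded converges_to_def]
  have "(\<lambda>n. dst V (s n) x + dst V (t n) y) \<longlonglongrightarrow> 0"
    using tendsto_add[of "\<lambda>n. dst V (s n) x" 0 sequentially "\<lambda>n. dst V (t n) y" 0] c by simp
  then show ?thesis
    using c by (intro converges_to_sandwich[where f = "\<lambda>n. dst V (s n) x + dst V (t n) y"])
      (auto simp: add_closed dst_add)
qed

lemma converges_to_scl:
  assumes "converges_to V s x" shows "converges_to V (\<lambda>n. scl V c (s n)) (scl V c x)"
  using assms tendsto_mult_left[of "\<lambda>n. dst V (s n) x" 0 sequentially "cmod c"]
  by (auto simp: converges_to_def scl_closed dst_scl)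

lemma converges_to_nrm:
  assumes "converges_to V s x" shows "(\<lambda>n. nrm V (s n)) \<longlonglongrightarrow> nrm V x"
proof -
  note c = assms[unfolded converges_to_def]
  have "(\<lambda>n. nrm V (s n) - nrm V x) \<longlonglongrightarrow> 0"
    by (rule Lim_null_comparison[where g = "\<lambda>n. dst V (s n) x"]) (use c nrm_diff in auto)
  then show ?thesis by (simp add: LIM_zero_iff)
qed

end


section \<open>Extending bounded operators to the completion\<close>

lemma linear_op_dst_le:
  assumes V: "cnormed_space V"
    and S: "linear_op V W S" "\<And>x. x \<in> carr V \<Longrightarrow> nrm W (S x) \<le> K * nrm V x"
    and xy: "x \<in> carr V" "y \<in> carr V"
  shows "dst W (S x) (S y) \<le> K * dst V x y"
proof -
  interpret V: cnormed_space V by (rule V)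
  have "add W (S x) (scl W (- 1) (S y)) = S (add V x (scl V (- 1) y))"
    using S(1) xy by (simp add: linear_op_def V.scl_closed)
  then show ?thesis
    using S(2)[of "add V x (scl V (- 1) y)"] xy by (simp add: dst_def V.add_closed V.scl_closed)
qed

text \<open>
  A bounded operator is Lipschitz, so its values on the completion are determined by
  those on the dense image of \<open>V\<close>.
\<close>

lemma bounded_op_completion_eqI:
  assumes V: "cnormed_space V" and W: "cnormed_space W"
    and T: "bounded_linear_op (cauchy_completion V) W T"
    and T': "bounded_linear_op (cauchy_completion V) W T'"
    and eq: "\<And>x. x \<in> carr V \<Longrightarrow> T (to_completion V x) = T' (to_completion V x)"
  shows "T = T'"
proof -
  interpret V: cnormed_space V by (rule V)
  interpret W: cnormed_space W by (rule W)
  let ?H = "cauchy_completion V"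
  interpret H: cnormed_space ?H by (rule V.cnormed_space_completion)
  obtain K K' where K: "\<And>X. X \<in> carr ?H \<Longrightarrow> nrm W (T X) \<le> K * nrm ?H X"
      "\<And>X. X \<in> carr ?H \<Longrightarrow> nrm W (T' X) \<le> K' * nrm ?H X"
    using T T' by (auto simp: bounded_linear_op_def)
  have lin: "linear_op ?H W T" "linear_op ?H W T'"
    using T T' by (auto simp: bounded_linear_op_def)
  then have carr: "T X \<in> carr W" "T' X \<in> carr W" if "X \<in> carr ?H" for X
    using that by (auto simp: linear_op_def)
  (* The summand 1 makes C positive, so that e / C is an admissible approximation error. *)
  define C where "C = \<bar>K\<bar> + \<bar>K'\<bar> + 1"
  have C: "0 < C" by (simp add: C_def)
  have "T X = T' X" if X: "X \<in> carr ?H" for X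
  proof -
    have "dst W (T X) (T' X) \<le> 0 + e" if e: "0 < e" for e
    proof -
      obtain x where x: "x \<in> carr V" and d: "dst ?H X (to_completion V x) < e / C"
        using V.embed_dense[OF X, of "e / C"] e C by auto
      note E = V.embed_carr[OF x]
      have "dst W (T X) (T' X) \<le> dst W (T X) (T (to_completion V x))
          + dst W (T' (to_completion V x)) (T' X)"
        unfolding eq[OF x, symmetric]
        by (rule W.dst_triangle) (use carr X E in auto)
      also have "\<dots> = dst W (T X) (T (to_completion V x)) + dst W (T' X) (T' (to_completion V x))"
        using W.dst_commute carr X E by simp
      also have "\<dots> \<le> K * dst ?H X (to_completion V x) + K' * dst ?H X (to_completion V x)"
        by (intro add_mono linear_op_dst_le[OF H.cnormed_space_axioms] lin K X E)
      also have "\<dots> \<le> C * dst ?H X (to_completion V x)"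
        unfolding distrib_right[symmetric]
        by (rule mult_right_mono) (auto simp: C_def H.dst_nonneg X E)
      also have "\<dots> \<le> e"
        using d C by (simp add: field_simps)
      finally show ?thesis by simp
    qed
    then have "dst W (T X) (T' X) \<le> 0" by (rule field_le_epsilon)
    then show ?thesis using W.dst_eq_0 W.dst_nonneg carr[OF X] by (metis antisym)
  qed
  then show ?thesis
    using T T' by (intro extensionalityI[of T "carr ?H" T']) (auto simp: bounded_linear_op_def)
qed

text \<open>
  The extension sends the class of a Cauchy sequence \<open>s\<close> to the limit of \<open>S (s n)\<close>. All its
  properties are inherited by passing to the limit along an arbitrary representative.
\<close>

theorem bounded_extension_ex1:
  assumes V: "cnormed_space V" and W: "cnormed_space W" "complete_space W"
    and S: "linear_op V W S" "\<And>x. x \<in> carr V \<Longrightarrow> nrm W (S x) \<le> K * nrm V x"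
  shows "\<exists>!T. bounded_linear_op (cauchy_completion V) W T \<and>
           (\<forall>x\<in>carr V. T (to_completion V x) = S x)"
proof -
  interpret V: cnormed_space V by (rule V)
  interpret W: cnormed_space W by (rule W)
  let ?H = "cauchy_completion V"
  define C where "C = \<bar>K\<bar> + 1"
  have C: "0 < C" by (simp add: C_def)
  have bd: "nrm W (S x) \<le> C * nrm V x" if "x \<in> carr V" for x
  proof -
    have "K * nrm V x \<le> C * nrm V x"
      by (rule mult_right_mono) (auto simp: C_def V.nrm_nonneg that)
    then show ?thesis using S(2)[OF that] by linarith
  qed
  have Sc: "S x \<in> carr W" if "x \<in> carr V" for x
    using S(1) that by (auto simp: linear_op_def)
  have lip: "dst W (S x) (S y) \<le> C * dst V x y" if "x \<in> carr V" "y \<in> carr V" for x y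
    by (rule linear_op_dst_le[OF V S(1) bd that])
  have lim_ex: "\<exists>y. converges_to W (\<lambda>n. S (s n)) y" if s: "s \<in> cauchy_seqs V" for s
  proof -
    note sc = V.cauchy_carr[OF s]
    have "(\<lambda>n. S (s n)) \<in> cauchy_seqs W"
    proof (rule W.cauchyI)
      fix e :: real assume e: "0 < e"
      obtain N where N: "\<forall>m\<ge>N. \<forall>n\<ge>N. dst V (s m) (s n) < e / C"
        using V.cauchyD[OF s, of "e / C"] e C by auto
      have "dst W (S (s m)) (S (s n)) < e" if "N \<le> m" "N \<le> n" for m n
      proof -
        have "C * dst V (s m) (s n) < e" using N that C by (simp add: field_simps)
        then show ?thesis using lip[OF sc sc, of m n] by linarith
      qed
      then show "\<exists>N. \<forall>m\<ge>N. \<forall>n\<ge>N. dst W (S (s m)) (S (s n)) < e" by blast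
    qed (simp add: Sc sc)
    then show ?thesis
      using W(2) Sc[OF sc] by (auto simp: complete_space_def converges_to_def)
  qed
  have lim_rel: "converges_to W (\<lambda>n. S (t n)) y"
    if st: "(s, t) \<in> null_rel V" and y: "converges_to W (\<lambda>n. S (s n)) y" for s t y
  proof (rule W.converges_to_sandwich[where f = "\<lambda>n. C * dst V (s n) (t n) + dst W (S (s n)) y"])
    note c = V.cauchy_carr[OF V.null_relD(1)[OF st]] V.cauchy_carr[OF V.null_relD(2)[OF st]]
    have yc: "y \<in> carr W" using y by (simp add: converges_to_def)
    show "y \<in> carr W" "S (t n) \<in> carr W" for n using yc Sc c by auto
    show "dst W (S (t n)) y \<le> C * dst V (s n) (t n) + dst W (S (s n)) y" for n
      using W.dst_triangle[OF Sc[OF c(2)] Sc[OF c(1)] yc, of n n] lip[OF c(1) c(2), of n n]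
        W.dst_commute[OF Sc[OF c(1)] Sc[OF c(2)], of n n] by linarith
    show "(\<lambda>n. C * dst V (s n) (t n) + dst W (S (s n)) y) \<longlonglongrightarrow> 0"
      using tendsto_add[OF tendsto_mult_left[OF V.null_relD(3)[OF st], of C], of _ 0] y
      by (simp add: converges_to_def)
  qed
  (* By lim_rel the images of all representatives of a class share one limit, which THE selects. *)
  define T where "T = restrict (\<lambda>X. THE y. \<forall>s\<in>X. converges_to W (\<lambda>n. S (s n)) y) (carr ?H)"
  have T_lim: "converges_to W (\<lambda>n. S (s n)) (T (V.cls s))" if s: "s \<in> cauchy_seqs V" for s
  proof -
    obtain y where y: "converges_to W (\<lambda>n. S (s n)) y" using lim_ex[OF s] by blast
    have "T (V.cls s) = (THE y. \<forall>t\<in>V.cls s. converges_to W (\<lambda>n. S (t n)) y)"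
      by (simp add: T_def V.cls_carr s del: Image_singleton_iff)
    also have "\<dots> = y"
    proof (rule the_equality)
      show "\<forall>t\<in>V.cls s. converges_to W (\<lambda>n. S (t n)) y" using lim_rel[OF _ y] by auto
      show "z = y" if "\<forall>t\<in>V.cls s. converges_to W (\<lambda>n. S (t n)) z" for z
        using that V.null_rel_refl[OF s] W.converges_to_unique[OF _ y] by auto
    qed
    finally show ?thesis using y by simp
  qed
  have T_eq: "T (V.cls s) = y" if "s \<in> cauchy_seqs V" "converges_to W (\<lambda>n. S (s n)) y" for s y
    using W.converges_to_unique[OF T_lim] that by blast
  have T_carr: "T (V.cls s) \<in> carr W" if "s \<in> cauchy_seqs V" for s
    using T_lim[OF that] by (simp add: converges_to_def)
  have T_add: "T (add ?H X Y) = add W (T X) (T Y)" if "X \<in> carr ?H" "Y \<in> carr ?H" for X Y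
  proof -
    obtain s where s: "s \<in> cauchy_seqs V" "X = V.cls s" by (rule V.cls_cases[OF \<open>X \<in> carr ?H\<close>])
    obtain t where t: "t \<in> cauchy_seqs V" "Y = V.cls t" by (rule V.cls_cases[OF \<open>Y \<in> carr ?H\<close>])
    have "S (add V (s n) (t n)) = add W (S (s n)) (S (t n))" for n
      using S(1) V.cauchy_carr[OF s(1)] V.cauchy_carr[OF t(1)] by (simp add: linear_op_def)
    then have "converges_to W (\<lambda>n. S (add V (s n) (t n))) (add W (T X) (T Y))"
      using W.converges_to_add[OF T_lim[OF s(1)] T_lim[OF t(1)]] unfolding s(2) t(2) by simp
    then show ?thesis
      unfolding s(2) t(2) V.completion_add[OF s(1) t(1)] by (rule T_eq[OF V.cauchy_add[OF s(1) t(1)]])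
  qed
  have T_scl: "T (scl ?H c X) = scl W c (T X)" if "X \<in> carr ?H" for c X
  proof -
    obtain s where s: "s \<in> cauchy_seqs V" "X = V.cls s" by (rule V.cls_cases[OF \<open>X \<in> carr ?H\<close>])
    have "S (scl V c (s n)) = scl W c (S (s n))" for n
      using S(1) V.cauchy_carr[OF s(1)] by (simp add: linear_op_def)
    then have "converges_to W (\<lambda>n. S (scl V c (s n))) (scl W c (T X))"
      using W.converges_to_scl[OF T_lim[OF s(1)]] unfolding s(2) by simp
    then show ?thesis
      unfolding s(2) V.completion_scl[OF s(1)] by (rule T_eq[OF V.cauchy_scl[OF s(1)]])
  qed
  have T_bd: "nrm W (T X) \<le> C * nrm ?H X" if "X \<in> carr ?H" for X
  proof -
    obtain s where s: "s \<in> cauchy_seqs V" "X = V.cls s" by (rule V.cls_cases[OF \<open>X \<in> carr ?H\<close>])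
    show ?thesis unfolding s(2)
      by (rule LIMSEQ_le[OF W.converges_to_nrm[OF T_lim[OF s(1)]]
            tendsto_mult_left[OF V.completion_nrm[OF s(1)]]])
         (use bd V.cauchy_carr[OF s(1)] in blast)
  qed
  have "T \<in> carr ?H \<rightarrow> carr W"
  proof
    show "T X \<in> carr W" if X: "X \<in> carr ?H" for X
      by (rule V.cls_cases[OF X]) (simp only: T_carr)
  qed
  moreover have "T \<in> extensional (carr ?H)"
    unfolding T_def by (rule restrict_extensional)
  ultimately have T: "bounded_linear_op ?H W T"
    unfolding bounded_linear_op_def linear_op_def
    using T_add T_scl T_bd by blast
  have ext: "T (to_completion V x) = S x" if "x \<in> carr V" for x
    unfolding to_completion_def
    by (intro T_eq V.cauchy_const W.converges_to_const Sc that)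
  show ?thesis
  proof (rule ex1I[of _ T])
    show "bounded_linear_op ?H W T \<and> (\<forall>x\<in>carr V. T (to_completion V x) = S x)"
      using T ext by blast
    show "T' = T" if "bounded_linear_op ?H W T' \<and> (\<forall>x\<in>carr V. T' (to_completion V x) = S x)" for T'
      using that T ext by (intro bounded_op_completion_eqI[OF V W(1)]) auto
  qed
qed


section \<open>Functions on the two end points\<close>

lemma complete_L2_ends: "complete_space (L2_ends a b)"
  unfolding complete_space_def
proof
  let ?L = "L2_ends a b"
  interpret L: cnormed_space ?L by (rule cnormed_space_L2_ends)
  fix s assume s: "s \<in> cauchy_seqs ?L"
  have dst: "dst ?L \<phi> \<psi> = sqrt ((cmod (\<phi> a - \<psi> a))\<^sup>2 + (cmod (\<phi> b - \<psi> b))\<^sup>2)" for \<phi> \<psi>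
    by (simp add: dst_def L2_ends_def)
  have "Cauchy (\<lambda>n. s n x)" if x: "x \<in> {a, b}" for x
  proof (rule metric_CauchyI)
    fix e :: real assume "0 < e"
    then obtain N where N: "\<forall>m\<ge>N. \<forall>n\<ge>N. dst ?L (s m) (s n) < e" using L.cauchyD[OF s] by blast
    have "dist (s m x) (s n x) \<le> dst ?L (s m) (s n)" for m n
      unfolding dst dist_norm using x by (intro real_le_rsqrt) auto
    then show "\<exists>M. \<forall>m\<ge>M. \<forall>n\<ge>M. dist (s m x) (s n x) < e"
      using N by (meson le_less_trans)
  qed
  then have "convergent (\<lambda>n. s n a)" "convergent (\<lambda>n. s n b)"
    by (simp_all add: Cauchy_convergent_iff)
  then obtain \<alpha> \<beta> where lim: "(\<lambda>n. s n a) \<longlonglongrightarrow> \<alpha>" "(\<lambda>n. s n b) \<longlonglongrightarrow> \<beta>"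
    unfolding convergent_def by blast
  define \<phi> where "\<phi> = (\<lambda>x. if x = a then \<alpha> else if x = b then \<beta> else 0)"
  have \<phi>: "(\<lambda>n. s n a) \<longlonglongrightarrow> \<phi> a" "(\<lambda>n. s n b) \<longlonglongrightarrow> \<phi> b"
    using lim by (auto simp: \<phi>_def)
  have "(\<lambda>n. dst ?L (s n) \<phi>) \<longlonglongrightarrow> sqrt ((cmod (\<phi> a - \<phi> a))\<^sup>2 + (cmod (\<phi> b - \<phi> b))\<^sup>2)"
    unfolding dst by (intro tendsto_intros \<phi>)
  then show "\<exists>\<phi>\<in>carr ?L. (\<lambda>n. dst ?L (s n) \<phi>) \<longlonglongrightarrow> 0"
    by (intro bexI[of _ \<phi>]) (auto simp: L2_ends_def \<phi>_def)
qed


section \<open>The trace inequality\<close>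

text \<open>
  The weight \<open>2 x - (a + b)\<close> takes the values \<open>b - a\<close> at \<open>b\<close> and \<open>a - b\<close> at \<open>a\<close>, so the
  fundamental theorem of calculus for \<open>(2 x - (a + b)) |u(x)|\<^sup>2\<close> yields both boundary values with the
  same positive sign.
\<close>

lemma C1_trace_identity:
  assumes "a < b" "u \<in> carr (C1 a b)"
  shows "((\<lambda>x. 2 * (cmod (u x))\<^sup>2 + (2 * x - (a + b)) * (2 * (u x \<bullet> deriv_on a b u x)))
     has_integral (b - a) * ((cmod (u a))\<^sup>2 + (cmod (u b))\<^sup>2)) {a..b}"
proof -
  define F where "F x = (2 * x - (a + b)) * (u x \<bullet> u x)" for x
  have "((\<lambda>x. 2 * (cmod (u x))\<^sup>2 + (2 * x - (a + b)) * (2 * (u x \<bullet> deriv_on a b u x)))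
     has_integral F b - F a) {a..b}"
  proof (rule fundamental_theorem_of_calculus)
    fix x assume x: "x \<in> {a..b}"
    have "(u has_derivative (\<lambda>h. h *\<^sub>R deriv_on a b u x)) (at x within {a..b})"
      using C1_has_deriv[OF assms(2) x] by (simp add: has_vector_derivative_def)
    then show "(F has_vector_derivative 2 * (cmod (u x))\<^sup>2
        + (2 * x - (a + b)) * (2 * (u x \<bullet> deriv_on a b u x))) (at x within {a..b})"
      unfolding F_def has_vector_derivative_def
      by (auto intro!: derivative_eq_intros
          simp: power2_norm_eq_inner inner_commute algebra_simps)
  qed (use assms in simp)
  moreover have "F b - F a = (b - a) * ((cmod (u a))\<^sup>2 + (cmod (u b))\<^sup>2)"
    by (simp add: F_def power2_norm_eq_inner algebra_simps)
  ultimately show ?thesis by simp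
qed

text \<open>
  The weight in the trace identity has modulus at most \<open>b - a\<close>, and the cross term satisfies
  \<open>2 |u| |u'| \<le> |u|\<^sup>2 + |u'|\<^sup>2\<close>; dividing by \<open>b - a\<close> gives the constant.
\<close>

lemma C1_trace_inequality:
  assumes "a < b" "u \<in> carr (C1 a b)"
  shows "nrm (L2_ends a b) (restr_ends a b u) \<le> sqrt (1 + 2 / (b - a)) * nrm (C1 a b) u"
proof -
  let ?U = "\<lambda>x. (cmod (u x))\<^sup>2" and ?D = "\<lambda>x. (cmod (deriv_on a b u x))\<^sup>2"
  note int = C1_integrable[OF assms(2)]
  have pointwise: "2 * ?U x + (2 * x - (a + b)) * (2 * (u x \<bullet> deriv_on a b u x))
      \<le> (2 + (b - a)) * ?U x + (b - a) * ?D x" if x: "x \<in> {a..b}" for x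
  proof -
    have "\<bar>2 * (u x \<bullet> deriv_on a b u x)\<bar> \<le> 2 * (cmod (u x) * cmod (deriv_on a b u x))"
      using Cauchy_Schwarz_ineq2[of "u x" "deriv_on a b u x"] by simp
    also have "\<dots> \<le> ?U x + ?D x"
      using sum_squares_bound[of "cmod (u x)" "cmod (deriv_on a b u x)"] by simp
    finally have "\<bar>2 * x - (a + b)\<bar> * \<bar>2 * (u x \<bullet> deriv_on a b u x)\<bar> \<le> (b - a) * (?U x + ?D x)"
      using x by (intro mult_mono) auto
    moreover have "(2 * x - (a + b)) * (2 * (u x \<bullet> deriv_on a b u x))
        \<le> \<bar>2 * x - (a + b)\<bar> * \<bar>2 * (u x \<bullet> deriv_on a b u x)\<bar>"
      by (metis abs_ge_self abs_mult)
    ultimately show ?thesis by (simp add: algebra_simps)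
  qed
  have rhs: "((\<lambda>x. (2 + (b - a)) * ?U x + (b - a) * ?D x) has_integral
      (2 + (b - a)) * integral {a..b} ?U + (b - a) * integral {a..b} ?D) {a..b}"
    by (intro has_integral_add has_integral_mult_right integrable_integral int)
  have "(b - a) * (?U a + ?U b)
      \<le> (2 + (b - a)) * integral {a..b} ?U + (b - a) * integral {a..b} ?D"
    using has_integral_le[OF C1_trace_identity[OF assms] rhs] pointwise by blast
  also have "\<dots> \<le> (2 + (b - a)) * (integral {a..b} ?U + integral {a..b} ?D)"
    using integral_nonneg[OF int(2)] by (simp add: algebra_simps)
  finally have "(b - a) * (?U a + ?U b) \<le> (2 + (b - a)) * (nrm (C1 a b) u)\<^sup>2"
    by (simp add: C1_nrm_sq)
  then have "?U a + ?U b \<le> (1 + 2 / (b - a)) * (nrm (C1 a b) u)\<^sup>2"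
    using assms(1) by (simp add: field_simps)
  then have "sqrt (?U a + ?U b) \<le> sqrt ((1 + 2 / (b - a)) * (nrm (C1 a b) u)\<^sup>2)"
    by simp
  then show ?thesis
    by (simp add: L2_ends_def restr_ends_def real_sqrt_mult C1_nrm_nonneg)
qed

theorem theorem2p3:
  fixes a b :: real
  assumes "a < b"
  shows "\<exists>!T. bounded_linear_op (H1 a b) (L2_ends a b) T \<and>
           (\<forall>u\<in>carr (C1 a b). T (to_completion (C1 a b) u) = restr_ends a b u)"
  unfolding H1_def
  by (rule bounded_extension_ex1[OF cnormed_space_C1[OF assms] cnormed_space_L2_ends
        complete_L2_ends linear_restr_ends C1_trace_inequality[OF assms]])

end
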